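(* Let $G$ be a finite nilpotent group. Then the proper enhanced power graph $\mathcal{G}_E^{**}(G)$ does not possess any total dominating set if and only if both of the following conditions hold: (1) $G$ is a $2$-group; and (2) $G$ has an element of order $2$ which is not contained in any other proper subgroup of order $2^k$, $k\geq 2$.
   Context: The enhanced power graph $\mathcal{G}_E(G)$ of a group $G$ is the simple graph with vertex set $G$ in which two distinct vertices $u,v$ are adjacent if and only if there is $w\in G$ with $u\in\langle w\rangle$ and $v\in\langle w\rangle$. A dominating vertex of a graph is a vertex adjacent to every other vertex; the identity of $G$ is always a dominating vertex of $\mathcal{G}_E(G)$. The proper enhanced power graph $\mathcal{G}_E^{**}(G)$ is the graph obtained from $\mathcal{G}_E(G)$ by deleting all of its dominating vertices. A total dominating set (or strongly dominating set) of a graph $\Gamma=(V,E)$ is a set $D\subseteq V$ such that every vertex $u\in V$ (including the vertices in $D$) is adjacent to some $v\in D$. A group $G$ is a $2$-group if $|G|=2^r$ for some positive integer $r$.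
   Formalization: In (2) "proper subgroup" is read as "proper cyclic subgroup" (as written, the claim fails for the dihedral group of order 8), and the proper enhanced power graph is assumed to have at least one vertex, i.e. G is not cyclic (with an empty graph the claim fails for the group of order 2). *)

theory Defs
  imports "HOL-Algebra.Algebra" "Graph_Theory.Graph_Theory"
begin

text \<open>
  Simple graphs are loop-free symmetric digraphs (locale \<open>graph\<close>), an edge being a pair of opposite
  arcs; \<open>u \<rightarrow>\<^bsub>\<Gamma>\<^esub> v\<close> is adjacency and \<open>\<Gamma> \<restriction> W\<close> the subgraph induced on \<open>W\<close>.
\<close>

definition enhanced_power_graph :: "('a, 'b) monoid_scheme \<Rightarrow> ('a, 'a \<times> 'a) pre_digraph" where
  "enhanced_power_graph G = with_proj
     \<lparr> pverts = carrier G,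
       parcs = {(u, v). u \<in> carrier G \<and> v \<in> carrier G \<and> u \<noteq> v \<and>
                  (\<exists>w\<in>carrier G. u \<in> generate G {w} \<and> v \<in> generate G {w})} \<rparr>"

lemma graph_enhanced_power_graph:
  assumes "finite (carrier G)"
  shows "graph (enhanced_power_graph G)"
proof -
  let ?P = "\<lparr> pverts = carrier G,
       parcs = {(u, v). u \<in> carrier G \<and> v \<in> carrier G \<and> u \<noteq> v \<and>
                  (\<exists>w\<in>carrier G. u \<in> generate G {w} \<and> v \<in> generate G {w})} \<rparr>"
  have "finite (parcs ?P)"
    by (rule finite_subset[of _ "carrier G \<times> carrier G"]) (use assms in auto)
  then have "pair_graph ?P"
    by unfold_locales (use assms in \<open>auto simp: symmetric_def intro!: symI\<close>)
  then show ?thesis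
    unfolding enhanced_power_graph_def by (rule pair_graph.pair_graphD_graph)
qed

definition dominating_vertices :: "('a, 'b) pre_digraph \<Rightarrow> 'a set" where
  "dominating_vertices \<Gamma> = {v \<in> verts \<Gamma>. \<forall>u\<in>verts \<Gamma>. u \<noteq> v \<longrightarrow> v \<rightarrow>\<^bsub>\<Gamma>\<^esub> u}"

definition proper_enhanced_power_graph ::
    "('a, 'b) monoid_scheme \<Rightarrow> ('a, 'a \<times> 'a) pre_digraph" where
  "proper_enhanced_power_graph G =
     enhanced_power_graph G \<restriction>
       (verts (enhanced_power_graph G) - dominating_vertices (enhanced_power_graph G))"

definition total_dominating_set :: "('a, 'b) pre_digraph \<Rightarrow> 'a set \<Rightarrow> bool" where
  "total_dominating_set \<Gamma> D \<longleftrightarrow> D \<subseteq> verts \<Gamma> \<and> (\<forall>u\<in>verts \<Gamma>. \<exists>v\<in>D. u \<rightarrow>\<^bsub>\<Gamma>\<^esub> v)"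

primrec lower_central_series :: "('a, 'b) monoid_scheme \<Rightarrow> nat \<Rightarrow> 'a set" where
  "lower_central_series G 0 = carrier G"
| "lower_central_series G (Suc n) =
     generate G (\<Union>a \<in> lower_central_series G n. \<Union>b \<in> carrier G.
       {a \<otimes>\<^bsub>G\<^esub> b \<otimes>\<^bsub>G\<^esub> inv\<^bsub>G\<^esub> a \<otimes>\<^bsub>G\<^esub> inv\<^bsub>G\<^esub> b})"

definition nilpotent_group :: "('a, 'b) monoid_scheme \<Rightarrow> bool" where
  "nilpotent_group G \<longleftrightarrow> group G \<and> (\<exists>n. lower_central_series G n = {\<one>\<^bsub>G\<^esub>})"

definition two_group :: "('a, 'b) monoid_scheme \<Rightarrow> bool" where
  "two_group G \<longleftrightarrow> group G \<and> (\<exists>r::nat. r > 0 \<and> order G = 2 ^ r)"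

text \<open>
  Two conventions of the theorem stated with these notions. In ``an element of order 2 not contained
  in any other proper subgroup of order \<open>2 ^ k\<close>, \<open>k \<ge> 2\<close>'', subgroup is read as cyclic subgroup:
  in the dihedral group of order 8 every involution lies in a Klein four-group, yet the
  non-central ones are isolated vertices of the proper enhanced power graph. And graphs have a
  non-empty vertex set: for cyclic \<open>G\<close> every vertex is dominating, so that the empty set
  would totally dominate what is left, and the equivalence would fail for the group of order 2.
\<close>

end

theory Submission
  imports Defs
begin

text \<open>
  A total dominating set exists iff the proper enhanced power graph has no isolated vertex, since
  then all its vertices together form one. If a cyclic subgroup \<open>\<langle>w\<rangle>\<close> with \<open>w \<noteq> x\<close>
  contains an isolated vertex \<open>x\<close>, then \<open>w\<close> is a neighbour of \<open>x\<close> and hence dominating, which would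
  make \<open>x\<close> dominating too. So \<open>x\<close> is an involution (take \<open>w = x\<inverse>\<close>) lying in no larger cyclic
  subgroup. An element \<open>z\<close> of odd prime order \<open>p\<close> would commute with \<open>x\<close> by nilpotency, giving
  \<open>x = (x z)\<^sup>p \<in> \<langle>x z\<rangle>\<close>; hence \<open>G\<close> is a 2-group.
\<close>

section \<open>Vertices, adjacency and domination in the two graphs\<close>

lemma verts_enhanced_power_graph [simp]: "verts (enhanced_power_graph G) = carrier G"
  by (simp add: enhanced_power_graph_def)

lemma adj_enhanced_power_graph:
  "u \<rightarrow>\<^bsub>enhanced_power_graph G\<^esub> v \<longleftrightarrow> u \<in> carrier G \<and> v \<in> carrier G \<and> u \<noteq> v \<and>
     (\<exists>w\<in>carrier G. u \<in> generate G {w} \<and> v \<in> generate G {w})"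
  by (auto simp: enhanced_power_graph_def arcs_ends_conv)

lemma verts_proper_enhanced_power_graph [simp]:
  "verts (proper_enhanced_power_graph G) =
     carrier G - dominating_vertices (enhanced_power_graph G)"
  by (simp add: proper_enhanced_power_graph_def)

lemma adj_proper_enhanced_power_graph:
  "u \<rightarrow>\<^bsub>proper_enhanced_power_graph G\<^esub> v \<longleftrightarrow>
     u \<in> verts (proper_enhanced_power_graph G) \<and> v \<in> verts (proper_enhanced_power_graph G) \<and>
     u \<rightarrow>\<^bsub>enhanced_power_graph G\<^esub> v"
  by (auto simp: proper_enhanced_power_graph_def arcs_ends_conv enhanced_power_graph_def)

lemma ex_total_dominating_set_iff:
  "(\<exists>D. total_dominating_set \<Gamma> D) \<longleftrightarrow> (\<forall>u\<in>verts \<Gamma>. \<exists>v\<in>verts \<Gamma>. u \<rightarrow>\<^bsub>\<Gamma>\<^esub> v)"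
  unfolding total_dominating_set_def by blast

lemma dominating_vertices_enhanced_power_graph:
  "v \<in> dominating_vertices (enhanced_power_graph G) \<longleftrightarrow> v \<in> carrier G \<and>
     (\<forall>u\<in>carrier G. u \<noteq> v \<longrightarrow> (\<exists>w\<in>carrier G. v \<in> generate G {w} \<and> u \<in> generate G {w}))"
  by (auto simp: dominating_vertices_def adj_enhanced_power_graph)

text \<open>Split off the full power of 2: a prime divisor of the remaining factor \<open>q\<close>
  would also divide \<open>n\<close>, hence be 2, which does not divide \<open>q\<close>.\<close>

lemma two_power_if_prime_divisor_two:
  assumes "n \<noteq> 0" and two: "\<And>p. Factorial_Ring.prime p \<Longrightarrow> p dvd n \<Longrightarrow> p = (2::nat)"
  obtains r where "n = 2 ^ r"
proof -
  obtain q where q: "n = 2 ^ multiplicity 2 n * q" "\<not> 2 dvd q"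
    using multiplicity_decompose'[of n 2] \<open>n \<noteq> 0\<close> by auto
  have "q = 1"
    using q two by (metis dvd_mult prime_factor_nat)
  then show thesis
    using q(1) that by simp
qed

section \<open>Dominating and isolated vertices in terms of cyclic subgroups\<close>

context group
begin

lemma generate_singleton_mono:
  assumes "w \<in> carrier G" "v \<in> generate G {w}"
  shows "generate G {v} \<subseteq> generate G {w}"
  using assms by (intro generate_subgroup_incl generate_is_subgroup) auto

lemma one_dominating: "\<one> \<in> dominating_vertices (enhanced_power_graph G)"
  by (auto simp: dominating_vertices_enhanced_power_graph intro: generate.one generate.incl)

text \<open>A cyclic subgroup that contains \<open>w\<close> contains all of its powers, so the
  generator that joins \<open>w\<close> to \<open>u\<close> also joins \<open>x\<close> to
  \<open>u\<close>.\<close>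

lemma dominating_if_generates_dominating:
  assumes w: "w \<in> dominating_vertices (enhanced_power_graph G)" and x: "x \<in> generate G {w}"
  shows "x \<in> dominating_vertices (enhanced_power_graph G)"
  unfolding dominating_vertices_enhanced_power_graph
proof (intro conjI ballI impI)
  have wG: "w \<in> carrier G"
    using w by (simp add: dominating_vertices_enhanced_power_graph)
  then show "x \<in> carrier G"
    using x generate_in_carrier[of "{w}" x] by auto
  fix u assume u: "u \<in> carrier G"
  \<comment> \<open>For \<open>u = w\<close> domination says nothing; there \<open>w\<close> itself
    is the common generator.\<close>
  have "\<exists>w'\<in>carrier G. w \<in> generate G {w'} \<and> u \<in> generate G {w'}"
    using w u wG generate.incl[of w "{w}" G]
    by (cases "u = w") (auto simp: dominating_vertices_enhanced_power_graph)
  then show "\<exists>w'\<in>carrier G. x \<in> generate G {w'} \<and> u \<in> generate G {w'}"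
    using x generate_singleton_mono by blast
qed

lemma isolated_proper_enhanced_power_graph:
  assumes x: "x \<in> verts (proper_enhanced_power_graph G)"
    and isolated: "\<not> (\<exists>v\<in>verts (proper_enhanced_power_graph G).
                        x \<rightarrow>\<^bsub>proper_enhanced_power_graph G\<^esub> v)"
    and w: "w \<in> carrier G" "x \<in> generate G {w}"
  shows "w = x"
proof (rule ccontr)
  assume "w \<noteq> x"
  then have "x \<rightarrow>\<^bsub>enhanced_power_graph G\<^esub> w"
    using x w generate.incl[of w "{w}" G] by (auto simp: adj_enhanced_power_graph)
  then have "w \<in> dominating_vertices (enhanced_power_graph G)"
    using x w isolated by (auto simp: adj_proper_enhanced_power_graph)
  then show False
    using dominating_if_generates_dominating w x by auto
qed

section \<open>Central commutators and coprime exponents\<close>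

lemma coprime_pow_eq_one:
  assumes c: "c \<in> carrier G" and "c [^] (m::nat) = \<one>" "c [^] (n::nat) = \<one>" "coprime m n"
  shows "c = \<one>"
proof -
  have "ord c dvd m" "ord c dvd n"
    using assms pow_eq_id by auto
  then have "ord c = 1"
    using \<open>coprime m n\<close> coprime_common_divisor_nat by blast
  then show ?thesis
    using c ord_eq_1 by blast
qed

lemma commutator_conj:
  assumes "g \<in> carrier G" "a \<in> carrier G" "b \<in> carrier G"
  shows "g \<otimes> (a \<otimes> b \<otimes> inv a \<otimes> inv b) \<otimes> inv g =
    (g \<otimes> a \<otimes> inv g) \<otimes> (g \<otimes> b \<otimes> inv g) \<otimes> inv (g \<otimes> a \<otimes> inv g) \<otimes> inv (g \<otimes> b \<otimes> inv g)"
proof -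
  \<comment> \<open>Once products are associated to the right, this rule cancels the inner pairs of
    \<open>g\<close> and its inverse.\<close>
  have "inv x \<otimes> (x \<otimes> y) = y" if "x \<in> carrier G" "y \<in> carrier G" for x y
    using that by (simp add: m_assoc[symmetric])
  then show ?thesis
    using assms by (simp add: m_assoc inv_mult_group)
qed

lemma commutator_eq_one_iff:
  assumes "a \<in> carrier G" "b \<in> carrier G"
  shows "a \<otimes> b \<otimes> inv a \<otimes> inv b = \<one> \<longleftrightarrow> a \<otimes> b = b \<otimes> a"
  using assms inv_solve_right[of \<one> "a \<otimes> b" "b \<otimes> a"]
  by (auto simp: inv_mult_group m_assoc)

text \<open>Here \<open>c\<close> is the commutator of \<open>a\<close> and \<open>b\<close>. Moving
  \<open>b\<close> to the left past one factor \<open>a\<close> releases one \<open>c\<close>, which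
  is central and can be collected in front.\<close>

lemma central_commutator_pow_left:
  assumes a: "a \<in> carrier G" and b: "b \<in> carrier G" and c: "c \<in> carrier G"
    and ab: "a \<otimes> b = c \<otimes> (b \<otimes> a)" and central: "\<And>g. g \<in> carrier G \<Longrightarrow> g \<otimes> c = c \<otimes> g"
  shows "a [^] (n::nat) \<otimes> b = c [^] n \<otimes> (b \<otimes> a [^] n)"
proof (induction n)
  case 0
  then show ?case using a b by simp
next
  case (Suc n)
  have "a [^] Suc n \<otimes> b = a [^] n \<otimes> (a \<otimes> b)"
    using a b by (simp add: m_assoc)
  also have "\<dots> = (a [^] n \<otimes> c) \<otimes> (b \<otimes> a)"
    using a b c ab by (simp add: m_assoc)
  also have "\<dots> = c \<otimes> (a [^] n \<otimes> b) \<otimes> a"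
    using a b c central[of "a [^] n"] by (simp add: m_assoc)
  also have "\<dots> = (c \<otimes> c [^] n) \<otimes> (b \<otimes> (a [^] n \<otimes> a))"
    using a b c Suc.IH by (simp add: m_assoc)
  also have "\<dots> = c [^] Suc n \<otimes> (b \<otimes> a [^] Suc n)"
    using a b c central[of "c [^] n"] by simp
  finally show ?case .
qed

lemma central_commutator_pow_eq_one:
  assumes a: "a \<in> carrier G" and b: "b \<in> carrier G" and c: "c \<in> carrier G"
    and ab: "a \<otimes> b = c \<otimes> (b \<otimes> a)" and central: "\<And>g. g \<in> carrier G \<Longrightarrow> g \<otimes> c = c \<otimes> g"
    and n: "a [^] (n::nat) = \<one>"
  shows "c [^] n = \<one>"
proof -
  have "b = c [^] n \<otimes> b"
    using central_commutator_pow_left[OF a b c ab central, of n] n b by simp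
  then show ?thesis
    using b c by (metis nat_pow_closed r_cancel_one)
qed

text \<open>The power of \<open>a\<close> shows that exponent \<open>m\<close> kills
  \<open>c\<close>, the power of \<open>b\<close> that exponent \<open>n\<close> does.\<close>

lemma central_commutator_coprime:
  assumes a: "a \<in> carrier G" and b: "b \<in> carrier G" and c: "c \<in> carrier G"
    and ab: "a \<otimes> b = c \<otimes> (b \<otimes> a)" and central: "\<And>g. g \<in> carrier G \<Longrightarrow> g \<otimes> c = c \<otimes> g"
    and "a [^] (m::nat) = \<one>" "b [^] (n::nat) = \<one>" "coprime m n"
  shows "c = \<one>"
proof (rule coprime_pow_eq_one[OF c _ _ \<open>coprime m n\<close>])
  show "c [^] m = \<one>"
    using central_commutator_pow_eq_one[OF a b c ab central] assms by blast
  \<comment> \<open>Exchanging \<open>a\<close> and \<open>b\<close> replaces \<open>c\<close> by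
    its inverse, which is again central.\<close>
  have "b \<otimes> a = inv c \<otimes> (a \<otimes> b)"
    using a b c ab by (simp add: inv_solve_left)
  moreover have "g \<otimes> inv c = inv c \<otimes> g" if "g \<in> carrier G" for g
    using c that central[of "inv g"]
    by (metis inv_closed inv_inv inv_mult_group)
  ultimately have "inv c [^] n = \<one>"
    using central_commutator_pow_eq_one[OF b a, of "inv c" n] c assms by blast
  then show "c [^] n = \<one>"
    using c by (metis nat_pow_inv inv_eq_1_iff nat_pow_closed)
qed

section \<open>Descending the lower central series through its quotients\<close>

lemma lower_central_series_normal: "lower_central_series G n \<lhd> G"
proof (induction n)
  case 0
  then show ?case by (simp add: normal_self)
next
  case (Suc n)
  interpret N: normal "lower_central_series G n" G by (fact Suc.IH)
  show ?case
    unfolding lower_central_series.simps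
  proof (rule normal_generateI)
    fix h g
    assume "h \<in> (\<Union>a \<in> lower_central_series G n. \<Union>b \<in> carrier G. {a \<otimes> b \<otimes> inv a \<otimes> inv b})"
      and g: "g \<in> carrier G"
    then obtain a b where ab: "a \<in> lower_central_series G n" "b \<in> carrier G"
      and h: "h = a \<otimes> b \<otimes> inv a \<otimes> inv b"
      by auto
    \<comment> \<open>Conjugation sends the commutator of \<open>a\<close> and \<open>b\<close> to
      that of their conjugates; by induction the first conjugate stays in the term, so the
      generating set is closed under conjugation.\<close>
    have "g \<otimes> a \<otimes> inv g \<in> lower_central_series G n" "g \<otimes> b \<otimes> inv g \<in> carrier G"
      using ab g N.inv_op_closed2 by auto
    then show "g \<otimes> h \<otimes> inv g \<in>
        (\<Union>a \<in> lower_central_series G n. \<Union>b \<in> carrier G. {a \<otimes> b \<otimes> inv a \<otimes> inv b})"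
      using commutator_conj[of g a b] ab g h N.mem_carrier by blast
  qed (use N.mem_carrier in auto)
qed

lemma commutator_in_lower_central_series_Suc:
  assumes "a \<in> lower_central_series G n" "b \<in> carrier G"
  shows "a \<otimes> b \<otimes> inv a \<otimes> inv b \<in> lower_central_series G (Suc n)"
  using assms by (auto intro!: generate.incl)

text \<open>Modulo the next term of the lower central series, the commutator is central.\<close>

lemma coprime_commutator_in_lower_central_series:
  assumes a: "a \<in> carrier G" "a [^] (m::nat) = \<one>" and b: "b \<in> carrier G" "b [^] (k::nat) = \<one>"
    and "coprime m k"
  shows "a \<otimes> b \<otimes> inv a \<otimes> inv b \<in> lower_central_series G n"
proof (induction n)
  case 0
  then show ?case using a b by simp
next
  case (Suc n)
  define N where "N = lower_central_series G (Suc n)"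
  define c where "c = a \<otimes> b \<otimes> inv a \<otimes> inv b"
  have c: "c \<in> carrier G" "c \<in> lower_central_series G n"
    using a b Suc.IH by (simp_all add: c_def)
  interpret N: normal N G unfolding N_def by (rule lower_central_series_normal)
  interpret Q: group "G Mod N" by (rule N.factorgroup_is_group)
  interpret q: group_hom G "G Mod N" "(#>) N"
    by (simp add: group_hom_axioms_def group_hom_def N.r_coset_hom_Mod Q.is_group)
  have ab: "a \<otimes> b = c \<otimes> (b \<otimes> a)"
    using a b by (simp add: c_def m_assoc inv_solve_left')
  \<comment> \<open>By induction \<open>c\<close> lies in term \<open>n\<close>, so its commutator
    with \<open>g\<close> falls into \<open>N\<close>.\<close>
  have swap: "N #> (g \<otimes> c) = N #> (c \<otimes> g)" if g: "g \<in> carrier G" for g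
  proof -
    have "c \<otimes> g \<otimes> inv (g \<otimes> c) \<in> N"
      using commutator_in_lower_central_series_Suc[OF c(2) g, folded N_def] c g
      by (simp add: inv_mult_group m_assoc)
    then show ?thesis
      using c g N.subgroup_axioms repr_independence[of "c \<otimes> g" N "g \<otimes> c"]
        N.rcos_module[of "g \<otimes> c" "c \<otimes> g"] is_group by auto
  qed
  \<comment> \<open>The images of \<open>a\<close> and \<open>b\<close> keep their coprime
    exponents, so their central commutator, the coset of \<open>c\<close>, is trivial.\<close>
  have "N #> c = \<one>\<^bsub>G Mod N\<^esub>"
  proof (rule Q.central_commutator_coprime[OF _ _ _ _ _ _ _ \<open>coprime m k\<close>])
    show "(N #> a) \<otimes>\<^bsub>G Mod N\<^esub> (N #> b) =
      (N #> c) \<otimes>\<^bsub>G Mod N\<^esub> ((N #> b) \<otimes>\<^bsub>G Mod N\<^esub> (N #> a))"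
      using a b c ab by (metis q.hom_mult m_closed)
    show "(N #> a) [^]\<^bsub>G Mod N\<^esub> m = \<one>\<^bsub>G Mod N\<^esub>"
      using a by (metis q.hom_nat_pow q.hom_one)
    show "(N #> b) [^]\<^bsub>G Mod N\<^esub> k = \<one>\<^bsub>G Mod N\<^esub>"
      using b by (metis q.hom_nat_pow q.hom_one)
    fix S assume "S \<in> carrier (G Mod N)"
    then obtain g where g: "g \<in> carrier G" "S = N #> g"
      by (auto simp: FactGroup_def RCOSETS_def)
    then show "S \<otimes>\<^bsub>G Mod N\<^esub> (N #> c) = (N #> c) \<otimes>\<^bsub>G Mod N\<^esub> S"
      using c swap by (metis q.hom_mult)
  qed (use a b c in \<open>auto intro: q.hom_closed\<close>)
  then have "N #> c = N"
    by (simp add: FactGroup_def)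
  then show ?case
    using c rcos_self[OF _ N.subgroup_axioms, of c] by (simp add: c_def N_def del: lower_central_series.simps)
qed

text \<open>The commutator lies in every term of the series, in particular in a trivial one.\<close>

lemma nilpotent_coprime_commute:
  assumes "nilpotent_group G"
    and a: "a \<in> carrier G" "a [^] (m::nat) = \<one>" and b: "b \<in> carrier G" "b [^] (k::nat) = \<one>"
    and "coprime m k"
  shows "a \<otimes> b = b \<otimes> a"
proof -
  obtain n where "lower_central_series G n = {\<one>}"
    using assms(1) by (auto simp: nilpotent_group_def)
  then show ?thesis
    using coprime_commutator_in_lower_central_series[OF a b \<open>coprime m k\<close>, of n]
      commutator_eq_one_iff a b by auto
qed

section \<open>Cauchy's theorem and the reduction to 2-groups\<close>

lemma exists_prime_torsion:
  assumes fin: "finite (carrier G)" and p: "Factorial_Ring.prime (p::nat)" "p dvd order G"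
  obtains z where "z \<in> carrier G" "z \<noteq> \<one>" "z [^] p = \<one>"
proof -
  \<comment> \<open>With exponent 1, Sylow's theorem yields a subgroup of order exactly
    \<open>p\<close>; any nontrivial element of it will do.\<close>
  obtain m where "order G = p ^ 1 * m"
    using p by auto
  then obtain H where H: "subgroup H G" "card H = p ^ 1"
    using sylow_thm[OF p(1) is_group _ fin] by blast
  have "\<not> H \<subseteq> {\<one>}"
    using H(2) p(1) card_mono[of "{\<one>}" H] prime_gt_1_nat[of p] by auto
  then obtain z where z: "z \<in> H" "z \<noteq> \<one>"
    by blast
  have "z [^]\<^bsub>G\<lparr>carrier := H\<rparr>\<^esub> order (G\<lparr>carrier := H\<rparr>) = \<one>\<^bsub>G\<lparr>carrier := H\<rparr>\<^esub>"
    using group.pow_order_eq_1[OF subgroup_imp_group[OF H(1)]] z by simp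
  then have "z [^] p = \<one>"
    using H(2) by (simp add: order_def nat_pow_consistent[symmetric])
  then show thesis
    using that z subgroup.mem_carrier[OF H(1)] by blast
qed

lemma two_group_if_isolated_involution:
  assumes fin: "finite (carrier G)" and nil: "nilpotent_group G"
    and x: "x \<in> carrier G" "ord x = 2"
    and maximal: "\<And>w. w \<in> carrier G \<Longrightarrow> x \<in> generate G {w} \<Longrightarrow> w = x"
  shows "two_group G"
proof -
  have x2: "x [^] (2::nat) = \<one>"
    using pow_ord_eq_1[OF x(1)] x(2) by simp
  have "p = 2" if p: "Factorial_Ring.prime p" "p dvd order G" for p :: nat
  proof (rule ccontr)
    assume "p \<noteq> 2"
    then have "odd p"
      using p prime_odd_nat prime_ge_2_nat[of p] by force
    obtain z where z: "z \<in> carrier G" "z \<noteq> \<one>" "z [^] p = \<one>"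
      using exists_prime_torsion[OF fin p] by blast
    have "x \<otimes> z = z \<otimes> x"
      using nilpotent_coprime_commute[OF nil x(1) x2 z(1,3)] \<open>odd p\<close> by simp
    \<comment> \<open>The factors commute and \<open>z [^] p\<close> is trivial; as \<open>p\<close>
      is odd and \<open>x\<close> an involution, what remains is \<open>x\<close>.\<close>
    then have "(x \<otimes> z) [^] p = x [^] p"
      using pow_mult_distrib[of x z p] x z by simp
    also have "\<dots> = x"
    proof -
      obtain j where "p = 2 * j + 1"
        using \<open>odd p\<close> oddE by blast
      then show ?thesis
        using x x2 by (simp add: nat_pow_pow[symmetric])
    qed
    finally have "x = (x \<otimes> z) [^] int p"
      by (simp add: int_pow_int)
    then have "x \<in> generate G {x \<otimes> z}"
      using generate_pow[of "x \<otimes> z"] x z by auto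
    then have "x \<otimes> z = x"
      using maximal x z by simp
    then show False
      using x z by simp
  qed
  moreover have "order G \<noteq> 0"
    using fin order_gt_0_iff_finite by simp
  ultimately obtain r where "order G = 2 ^ r"
    using two_power_if_prime_divisor_two by blast
  \<comment> \<open>This excludes the exponent 0, which \<open>two_group\<close> does not
    allow.\<close>
  moreover have "order G \<noteq> 1"
    using ord_dvd_group_order[OF x(1)] x(2) by auto
  ultimately show ?thesis
    unfolding two_group_def using is_group \<open>order G = 2 ^ r\<close> by (cases r) auto
qed

end

section \<open>The equivalence, by way of isolated vertices\<close>

theorem theorem2p1:
  fixes G :: "('a, 'b) monoid_scheme"
  assumes "group G"
    and "finite (carrier G)"
    and "nilpotent_group G"
    and "verts (proper_enhanced_power_graph G) \<noteq> {}"
  shows "\<not> (\<exists>D. total_dominating_set (proper_enhanced_power_graph G) D) \<longleftrightarrow>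
    two_group G \<and>
    (\<exists>x\<in>carrier G. group.ord G x = 2 \<and>
       \<not> (\<exists>H. \<exists>k::nat. subgroup H G \<and> H \<noteq> carrier G \<and> cyclic_group (G\<lparr>carrier := H\<rparr>) \<and>
              k \<ge> 2 \<and> card H = 2 ^ k \<and> x \<in> H))"
    (is "\<not> (\<exists>D. total_dominating_set ?P D) \<longleftrightarrow> two_group G \<and> (\<exists>x\<in>carrier G. ?max x)")
proof -
  interpret group G by fact
  note fin = \<open>finite (carrier G)\<close>
  show ?thesis
  proof
    assume "\<not> (\<exists>D. total_dominating_set ?P D)"
    then obtain x where x: "x \<in> verts ?P" and iso: "\<not> (\<exists>v\<in>verts ?P. x \<rightarrow>\<^bsub>?P\<^esub> v)"
      unfolding ex_total_dominating_set_iff by blast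
    note maximal = isolated_proper_enhanced_power_graph[OF x iso]
    have xG: "x \<in> carrier G" and "x \<noteq> \<one>\<^bsub>G\<^esub>"
      using x one_dominating by auto
    have "x \<in> generate G {inv\<^bsub>G\<^esub> x}"
      using xG generate.inv[of "inv\<^bsub>G\<^esub> x" "{inv\<^bsub>G\<^esub> x}" G] by simp
    then have "inv\<^bsub>G\<^esub> x = x"
      using maximal xG by simp
    then have "x [^]\<^bsub>G\<^esub> (2::nat) = \<one>\<^bsub>G\<^esub>"
      using xG r_inv[of x] by (simp add: numeral_2_eq_2)
    then have "ord x dvd 2"
      using pow_eq_id xG by blast
    then have ord: "ord x = 2"
      using ord_eq_1[OF xG] \<open>x \<noteq> \<one>\<^bsub>G\<^esub>\<close> by (metis prime_nat_iff two_is_prime_nat)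
    have "?max x"
    proof (intro conjI notI)
      show "ord x = 2" by fact
      assume "\<exists>H. \<exists>k::nat. subgroup H G \<and> H \<noteq> carrier G \<and> cyclic_group (G\<lparr>carrier := H\<rparr>) \<and>
              k \<ge> 2 \<and> card H = 2 ^ k \<and> x \<in> H"
      then obtain H k where H: "subgroup H G" "cyclic_group (G\<lparr>carrier := H\<rparr>)"
        and k: "(k::nat) \<ge> 2" "card H = 2 ^ k" "x \<in> H"
        by blast
      interpret H: group "G\<lparr>carrier := H\<rparr>" by (rule subgroup_imp_group[OF H(1)])
      \<comment> \<open>A generator of \<open>H\<close>, with powers taken inside \<open>H\<close>,
        also generates \<open>H\<close> in \<open>G\<close>. Maximality then forces
        \<open>h = x\<close>, so \<open>H\<close> has order 2 and not \<open>2 ^ k\<close> with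
        \<open>k \<ge> 2\<close>.\<close>
      obtain h where h: "h \<in> H" "H = range (\<lambda>n::int. h [^]\<^bsub>G\<lparr>carrier := H\<rparr>\<^esub> n)"
        using H(2) unfolding H.cyclic_group by auto
      then have hG: "h \<in> carrier G"
        using subgroup.mem_carrier[OF H(1)] by blast
      have gen: "H = generate G {h}"
        using h(2) unfolding generate_pow[OF hG] int_pow_consistent[OF H(1) h(1), symmetric]
        by (simp add: full_SetCompr_eq)
      then have "h = x"
        using maximal[OF hG] k(3) gen by blast
      then have "card H = 2"
        using generate_pow_card[OF xG] ord gen by simp
      then have "(2::nat) ^ k = 2 ^ 1"
        using k by simp
      then show False
        using k(1) power_inject_exp[of "2::nat" k 1] by simp
    qed
    moreover have "two_group G"
      using two_group_if_isolated_involution[OF fin \<open>nilpotent_group G\<close> xG ord maximal] .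
    ultimately show "two_group G \<and> (\<exists>x\<in>carrier G. ?max x)"
      using xG by blast
  next
    assume "two_group G \<and> (\<exists>x\<in>carrier G. ?max x)"
    then obtain x r where x: "x \<in> carrier G" and ord: "ord x = 2" and "?max x"
      and r: "order G = 2 ^ (r::nat)"
      unfolding two_group_def by blast
    have "x \<noteq> \<one>\<^bsub>G\<^esub>"
      using ord by auto
    \<comment> \<open>In a cyclic group every vertex dominates and the proper graph would be empty.
      This supplies the properness of \<open>H\<close> that the condition on \<open>x\<close> asks
      for.\<close>
    have noncyclic: "generate G {w} \<noteq> carrier G" if "w \<in> carrier G" for w
    proof
      assume "generate G {w} = carrier G"
      then have "carrier G \<subseteq> dominating_vertices (enhanced_power_graph G)"
        using that unfolding subset_iff dominating_vertices_enhanced_power_graph by blast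
      then show False
        using assms(4) by simp
    qed
    \<comment> \<open>The order of this cyclic subgroup divides a power of 2, hence is
      \<open>2 ^ k\<close>; the condition on \<open>x\<close> leaves only \<open>k < 2\<close>, and
      the two elements \<open>\<one>\<close> and \<open>x\<close> already fill it.\<close>
    have small: "generate G {w} = {\<one>\<^bsub>G\<^esub>, x}" if w: "w \<in> carrier G" "x \<in> generate G {w}" for w
    proof -
      let ?H = "generate G {w}"
      have H: "subgroup ?H G"
        using w by (intro generate_is_subgroup) auto
      have "card ?H dvd 2 ^ r"
        using lagrange[OF H] r by (metis dvd_triv_right)
      then obtain k where k: "card ?H = 2 ^ k"
        using divides_primepow_nat[OF two_is_prime_nat] by blast
      have "cyclic_group (G\<lparr>carrier := ?H\<rparr>)"
        using cyclic_group_generated[of w] w by (simp add: subgroup_generated_def)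
      then have "k < 2"
        using \<open>?max x\<close> H noncyclic[OF w(1)] k w(2) by (meson not_less)
      then have "card ?H \<le> 2"
        using k by (auto simp: less_2_cases_iff)
      moreover have "finite ?H"
        using finite_subset[OF subgroup.subset[OF H] fin] .
      moreover have "{\<one>\<^bsub>G\<^esub>, x} \<subseteq> ?H" "card {\<one>\<^bsub>G\<^esub>, x} = 2"
        using w generate.one[of G "{w}"] \<open>x \<noteq> \<one>\<^bsub>G\<^esub>\<close> by auto
      ultimately show ?thesis
        by (metis card_seteq)
    qed
    \<comment> \<open>If \<open>x\<close> were dominating, every \<open>u\<close> would share a
      cyclic subgroup with \<open>x\<close> and so lie in the set from \<open>small\<close>; then
      \<open>x\<close> would generate \<open>G\<close>.\<close>
    have "x \<in> verts ?P"
    proof (rule ccontr)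
      assume "x \<notin> verts ?P"
      then have dom: "x \<in> dominating_vertices (enhanced_power_graph G)"
        using x by simp
      have genx: "generate G {x} = {\<one>\<^bsub>G\<^esub>, x}"
        using small x by (simp add: generate.incl)
      have "u \<in> {\<one>\<^bsub>G\<^esub>, x}" if "u \<in> carrier G" for u
        using that dom small unfolding dominating_vertices_enhanced_power_graph by blast
      then show False
        using genx noncyclic[OF x] x by auto
    qed
    \<comment> \<open>By \<open>small\<close> the identity is the only possible neighbour of
      \<open>x\<close>, and it has been deleted as a dominating vertex.\<close>
    moreover have "\<not> x \<rightarrow>\<^bsub>?P\<^esub> v" for v
    proof
      assume v: "x \<rightarrow>\<^bsub>?P\<^esub> v"
      then have "v = \<one>\<^bsub>G\<^esub>"
        using small unfolding adj_proper_enhanced_power_graph adj_enhanced_power_graph by blast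
      then show False
        using v one_dominating by (simp add: adj_proper_enhanced_power_graph)
    qed
    ultimately show "\<not> (\<exists>D. total_dominating_set ?P D)"
      unfolding ex_total_dominating_set_iff by blast
  qed
qed

end
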